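(* Let $d\ge 1$ and $p\ge 1$ be integers, let $\boldsymbol{\mu}\in\mathbb{R}^d$, let $\boldsymbol{\Sigma}\in\mathbb{R}^{d\times d}$ be symmetric positive definite with Cholesky decomposition $\boldsymbol{\Sigma}=\mathbf{A}\mathbf{A}^T$, $\mathbf{A}$ lower triangular, and let $\boldsymbol{\eta}=[\eta_1,\ldots,\eta_d]^T$ be a random vector with the standard Gaussian distribution on $\mathbb{R}^d$. Then for every multi-index $\boldsymbol{\alpha}\in\mathbb{N}^d$ with $|\boldsymbol{\alpha}|\le 2p$ there exist positive integers $r_0,r_1,\ldots,r_d$ with $r_d=1$, a constant matrix $\mathbf{G}_0\in\mathbb{R}^{1\times r_0}$, and univariate matrix-valued functions $\mathbf{G}_i(\eta_i)\in\mathbb{R}^{r_{i-1}\times r_i}$, $i=1,\ldots,d$ (each depending only on $\eta_i$, with entries of finite expectation), such that $$(\mathbf{A}\boldsymbol{\eta}+\boldsymbol{\mu})^{\boldsymbol{\alpha}}=\mathbf{G}_0\,\mathbf{G}_1(\eta_1)\,\mathbf{G}_2(\eta_2)\cdots\mathbf{G}_d(\eta_d)\quad\text{for all }\boldsymbol{\eta}\in\mathbb{R}^d,$$ and consequently the moment $q_{\boldsymbol{\alpha}}=\int_{\mathbb{R}^d}\boldsymbol{\xi}^{\boldsymbol{\alpha}}\,\mathcal{N}(\boldsymbol{\xi}\,|\,\boldsymbol{\mu},\boldsymbol{\Sigma})\,d\boldsymbol{\xi}$ is given exactly by $$q_{\boldsymbol{\alpha}}=\mathbf{G}_0\,\mathb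b{E}[\mathbf{G}_1(\eta_1)]\,\mathbb{E}[\mathbf{G}_2(\eta_2)]\cdots\mathbb{E}[\mathbf{G}_d(\eta_d)].$$
   Context: $\mathcal{N}(\boldsymbol{\xi}\,|\,\boldsymbol{\mu},\boldsymbol{\Sigma})$ is the multivariate Gaussian density with mean $\boldsymbol{\mu}$ and covariance matrix $\boldsymbol{\Sigma}$. For $\boldsymbol{\alpha}=[\alpha_1,\ldots,\alpha_d]\in\mathbb{N}^d$ (with $0\in\mathbb{N}$) and $\mathbf{x}\in\mathbb{R}^d$, $|\boldsymbol{\alpha}|=\alpha_1+\cdots+\alpha_d$ and $\mathbf{x}^{\boldsymbol{\alpha}}=x_1^{\alpha_1}\cdots x_d^{\alpha_d}$. Expectations of matrices are taken entrywise with respect to the standard Gaussian distribution of $\boldsymbol{\eta}$. *)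

theory Defs
  imports "HOL-Probability.Probability" "Jordan_Normal_Form.Gauss_Jordan_Elimination"
    "Jordan_Normal_Form.Determinant"
begin

(* Vectors and matrices are those of Jordan_Normal_Form (explicit dimensions, indices from 0);
   the homonymous HOL-Analysis notions are hidden. *)
hide_type (open) Finite_Cartesian_Product.vec
hide_const (open) Finite_Cartesian_Product.vec Finite_Cartesian_Product.mat
  Finite_Cartesian_Product.row Finite_Cartesian_Product.column
  Finite_Cartesian_Product.transpose Determinants.det
unbundle no vec_syntax
unbundle no inner_syntax

definition lower_triangular :: "'a::zero mat \<Rightarrow> bool" where
  "lower_triangular A \<longleftrightarrow> (\<forall>i < dim_row A. \<forall>j < dim_col A. i < j \<longrightarrow> A $$ (i, j) = 0)"

definition sym_pos_def :: "nat \<Rightarrow> real mat \<Rightarrow> bool" where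
  "sym_pos_def d S \<longleftrightarrow> S \<in> carrier_mat d d \<and> S\<^sup>T = S \<and>
     (\<forall>x \<in> carrier_vec d. x \<noteq> 0\<^sub>v d \<longrightarrow> x \<bullet> (S *\<^sub>v x) > 0)"

(* Only meaningful for invertible S, where mat_inverse S = Some (S^(-1)). *)
definition gauss_density :: "nat \<Rightarrow> real vec \<Rightarrow> real mat \<Rightarrow> real vec \<Rightarrow> real" where
  "gauss_density d m S x =
     exp (- ((x - m) \<bullet> (the (mat_inverse S) *\<^sub>v (x - m))) / 2) / sqrt ((2 * pi) ^ d * det S)"

(* Lebesgue measure on R^d; its points are functions on {..<d}, and vec d x is the
   corresponding vector. *)
definition lborel_dim :: "nat \<Rightarrow> (nat \<Rightarrow> real) measure" where
  "lborel_dim d = PiM {..<d} (\<lambda>_. lborel)"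

definition monom_vec :: "real vec \<Rightarrow> nat vec \<Rightarrow> real" where
  "monom_vec x \<alpha> = (\<Prod>i < dim_vec \<alpha>. (x $ i) ^ (\<alpha> $ i))"

definition gauss_moment :: "nat \<Rightarrow> real vec \<Rightarrow> real mat \<Rightarrow> nat vec \<Rightarrow> real" where
  "gauss_moment d m S \<alpha> =
     (\<integral>x. monom_vec (vec d x) \<alpha> * gauss_density d m S (vec d x) \<partial>lborel_dim d)"

definition std_gaussian_vec :: "'w measure \<Rightarrow> nat \<Rightarrow> ('w \<Rightarrow> nat \<Rightarrow> real) \<Rightarrow> bool" where
  "std_gaussian_vec M d \<eta> \<longleftrightarrow>
     distributed M (lborel_dim d) \<eta> (\<lambda>x. ennreal (gauss_density d (0\<^sub>v d) (1\<^sub>m d) (vec d x)))"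

definition expectation_mat :: "'w measure \<Rightarrow> nat \<Rightarrow> nat \<Rightarrow> ('w \<Rightarrow> real mat) \<Rightarrow> real mat" where
  "expectation_mat M nr nc X = mat nr nc (\<lambda>(a, b). \<integral>\<omega>. X \<omega> $$ (a, b) \<partial>M)"

(* G0 * H 1 * H 2 * ... * H d *)
definition mat_chain :: "real mat \<Rightarrow> (nat \<Rightarrow> real mat) \<Rightarrow> nat \<Rightarrow> real mat" where
  "mat_chain G0 H d = foldl (*) G0 (map H [1..<Suc d])"

end

(* Expanding (A x + mu)^alpha into N monomials c_k * x^(e_k) gives a tensor train at once: G_0 is the
   row (c_k), the cores G_1, ..., G_(d-1) are diagonal with entries x_i^(e_k(i)), and G_d is the column
   of the last factors; since expectation acts entrywise, it commutes with this product by independence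
   of the coordinates.  The moment itself is pulled back to the standard Gaussian along x = A y + mu;
   because A is triangular, that change of variables is Fubini plus a one-dimensional affine
   substitution in each coordinate. *)
theory Submission
  imports Defs
begin

section \<open>Diagonal tensor trains\<close>

text \<open>Core \<open>i\<close> of a canonical polyadic decomposition with \<open>N\<close> terms,
  read as a tensor train. At \<open>i = d\<close> the condition
  \<open>i < d \<longrightarrow> a = b\<close> is vacuous, so the last core is a full
  column.\<close>

definition cp_core :: "nat \<Rightarrow> nat \<Rightarrow> nat \<Rightarrow> (nat \<Rightarrow> real) \<Rightarrow> real mat" where
  "cp_core d N i h =
     mat N (if i < d then N else 1) (\<lambda>(a, b). if i < d \<longrightarrow> a = b then h a else 0)"

lemma mat_chain_Suc: "mat_chain G0 H (Suc j) = mat_chain G0 H j * H (Suc j)"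
  by (simp add: mat_chain_def)

lemma mat_chain_cong:
  assumes "\<And>i. i \<in> {1..d} \<Longrightarrow> H i = H' i"
  shows "mat_chain G0 H d = mat_chain G0 H' d"
proof -
  have "map H [1..<Suc d] = map H' [1..<Suc d]"
    using assms by (intro map_cong) auto
  then show ?thesis by (simp only: mat_chain_def)
qed

text \<open>A row times a diagonal core is scaled entry by entry, so the \<open>N\<close> terms
  never mix before the last core.\<close>

lemma mat_chain_cp_core_prefix:
  assumes "G0 \<in> carrier_mat 1 N" "j < d"
  shows "mat_chain G0 (\<lambda>i. cp_core d N i (h i)) j =
    mat 1 N (\<lambda>(_, a). G0 $$ (0, a) * (\<Prod>i = 1..j. h i a))"
  using assms(2)
proof (induction j)
  case 0
  show ?case using assms(1) by (intro eq_matI) (auto simp: mat_chain_def)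
next
  case (Suc j)
  then have IH: "mat_chain G0 (\<lambda>i. cp_core d N i (h i)) j =
    mat 1 N (\<lambda>(_, a). G0 $$ (0, a) * (\<Prod>i = 1..j. h i a))" by simp
  show ?case
    unfolding mat_chain_Suc IH
    using Suc.prems
    by (intro eq_matI)
      (auto simp: cp_core_def scalar_prod_def if_distrib[of "\<lambda>u. _ * u"] sum.delta cong: if_cong)
qed

text \<open>The column at position \<open>d\<close> performs the summation: its product with the row
  of partial products is a scalar product over the terms.\<close>

lemma mat_chain_cp_core:
  assumes "G0 \<in> carrier_mat 1 N" "d \<ge> 1"
  shows "mat_chain G0 (\<lambda>i. cp_core d N i (h i)) d $$ (0, 0) =
    (\<Sum>a<N. G0 $$ (0, a) * (\<Prod>i = 1..d. h i a))"
proof -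
  obtain j where d: "d = Suc j" using assms(2) by (cases d) auto
  show ?thesis
    unfolding d mat_chain_Suc
    by (subst mat_chain_cp_core_prefix[OF assms(1)])
      (auto simp: cp_core_def scalar_prod_def atLeast0LessThan intro!: sum.cong)
qed

section \<open>Polynomial functions as sums of monomials\<close>

text \<open>In a list the same exponent may occur twice, so two such functions are added by
  \<open>@\<close>, without collecting terms.\<close>

definition monomial_sum :: "(real \<times> (nat \<Rightarrow> nat)) list \<Rightarrow> nat \<Rightarrow> real vec \<Rightarrow> real" where
  "monomial_sum L d x = (\<Sum>(c, e)\<leftarrow>L. c * (\<Prod>i<d. (x $ i) ^ e i))"

text \<open>The equation is asked for at every \<open>x\<close>, of any dimension, which makes it an
  equality of functions that the closure lemmas can substitute.\<close>

definition polynomial_fun :: "nat \<Rightarrow> (real vec \<Rightarrow> real) \<Rightarrow> bool" where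
  "polynomial_fun d f \<longleftrightarrow> (\<exists>L. \<forall>x. f x = monomial_sum L d x)"

lemma polynomial_fun_const: "polynomial_fun d (\<lambda>_. c)"
  unfolding polynomial_fun_def monomial_sum_def
  by (intro exI[of _ "[(c, \<lambda>_. 0)]"]) simp

lemma polynomial_fun_coord:
  assumes "i < d"
  shows "polynomial_fun d (\<lambda>x. x $ i)"
proof -
  have "(\<Prod>k<d. (x $ k) ^ (if k = i then 1 else 0)) = x $ i" for x :: "real vec"
    using assms by (simp add: if_distrib[of "\<lambda>n. _ ^ n"] prod.delta cong: if_cong)
  then show ?thesis
    unfolding polynomial_fun_def monomial_sum_def
    by (intro exI[of _ "[(1, \<lambda>k. if k = i then 1 else 0)]"]) simp
qed

lemma polynomial_fun_add:
  assumes "polynomial_fun d f" "polynomial_fun d g"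
  shows "polynomial_fun d (\<lambda>x. f x + g x)"
proof -
  obtain L L' where "f = monomial_sum L d" "g = monomial_sum L' d"
    using assms unfolding polynomial_fun_def by blast
  then show ?thesis
    unfolding polynomial_fun_def by (intro exI[of _ "L @ L'"]) (simp add: monomial_sum_def)
qed

text \<open>Multiplying by one monomial adds its exponents to those of each list entry; this is the
  distributive step in \<open>polynomial_fun_mult\<close>.\<close>

lemma monomial_sum_scale:
  "monomial_sum (map (\<lambda>(c', e'). (c * c', \<lambda>i. e i + e' i)) L) d x =
     c * (\<Prod>i<d. (x $ i) ^ e i) * monomial_sum L d x"
  by (induction L) (auto simp: monomial_sum_def power_add prod.distrib algebra_simps)

lemma polynomial_fun_mult:
  assumes "polynomial_fun d f" "polynomial_fun d g"
  shows "polynomial_fun d (\<lambda>x. f x * g x)"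
proof -
  obtain L L' where fg: "f = monomial_sum L d" "g = monomial_sum L' d"
    using assms unfolding polynomial_fun_def by blast
  have "\<exists>K. \<forall>x. monomial_sum L d x * monomial_sum L' d x = monomial_sum K d x"
  proof (induction L)
    case Nil
    show ?case by (intro exI[of _ "[]"]) (simp add: monomial_sum_def)
  next
    case (Cons m L)
    obtain c e where m: "m = (c, e)" by (cases m)
    obtain K where "\<forall>x. monomial_sum L d x * monomial_sum L' d x = monomial_sum K d x"
      using Cons.IH by blast
    moreover have "monomial_sum (m # L) d x * monomial_sum L' d x =
        c * (\<Prod>i<d. (x $ i) ^ e i) * monomial_sum L' d x + monomial_sum L d x * monomial_sum L' d x"
      for x by (simp add: m monomial_sum_def algebra_simps)
    moreover have "monomial_sum (K' @ K) d x = monomial_sum K' d x + monomial_sum K d x" for K' K x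
      by (simp add: monomial_sum_def)
    ultimately show ?case
      by (intro exI[of _ "map (\<lambda>(c', e'). (c * c', \<lambda>i. e i + e' i)) L' @ K"])
        (simp add: monomial_sum_scale)
  qed
  then show ?thesis by (simp add: polynomial_fun_def fg)
qed

lemma polynomial_fun_sum:
  assumes "\<And>i. i \<in> I \<Longrightarrow> polynomial_fun d (f i)"
  shows "polynomial_fun d (\<lambda>x. \<Sum>i\<in>I. f i x)"
  using assms
  by (induction I rule: infinite_finite_induct)
    (auto intro: polynomial_fun_const polynomial_fun_add)

lemma polynomial_fun_prod:
  assumes "\<And>i. i \<in> I \<Longrightarrow> polynomial_fun d (f i)"
  shows "polynomial_fun d (\<lambda>x. \<Prod>i\<in>I. f i x)"
  using assms
  by (induction I rule: infinite_finite_induct)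
    (auto intro: polynomial_fun_const polynomial_fun_mult)

lemma polynomial_fun_power:
  assumes "polynomial_fun d f"
  shows "polynomial_fun d (\<lambda>x. f x ^ n)"
  using assms by (induction n) (auto intro: polynomial_fun_const polynomial_fun_mult)

lemma polynomial_fun_monom_affine:
  assumes A: "A \<in> carrier_mat d d" and \<mu>: "\<mu> \<in> carrier_vec d" and \<alpha>: "\<alpha> \<in> carrier_vec d"
  obtains N :: nat and c e where "N \<ge> 1"
    "\<forall>x\<in>carrier_vec d.
      monom_vec (A *\<^sub>v x + \<mu>) \<alpha> = (\<Sum>k<N. c k * (\<Prod>i<d. (x $ i) ^ e k i))"
proof -
  \<comment> \<open>The coordinates of the affine map are spelled out as sums that are polynomial in
    every \<open>x\<close>; \<open>A *\<^sub>v x + \<mu>\<close> has these coordinates for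
    \<open>x\<close> in \<open>carrier_vec d\<close>.\<close>
  have "polynomial_fun d (\<lambda>x. \<Prod>i<d. ((\<Sum>j<d. A $$ (i, j) * x $ j) + \<mu> $ i) ^ (\<alpha> $ i))"
    by (intro polynomial_fun_prod polynomial_fun_power polynomial_fun_add polynomial_fun_sum
        polynomial_fun_mult polynomial_fun_const polynomial_fun_coord) auto
  then obtain L where L: "\<And>x. (\<Prod>i<d. ((\<Sum>j<d. A $$ (i, j) * x $ j) + \<mu> $ i) ^ (\<alpha> $ i)) =
      monomial_sum L d x"
    unfolding polynomial_fun_def by blast
  \<comment> \<open>The zero monomial makes the list nonempty, so that \<open>N \<ge> 1\<close> and
    the ranks are positive.\<close>
  define L' where "L' = (0, \<lambda>_. 0) # L"
  have "monom_vec (A *\<^sub>v x + \<mu>) \<alpha> =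
      (\<Sum>k<length L'. fst (L' ! k) * (\<Prod>i<d. (x $ i) ^ snd (L' ! k) i))"
    if x: "x \<in> carrier_vec d" for x
  proof -
    have "monom_vec (A *\<^sub>v x + \<mu>) \<alpha> =
        (\<Prod>i<d. ((\<Sum>j<d. A $$ (i, j) * x $ j) + \<mu> $ i) ^ (\<alpha> $ i))"
      using A \<mu> \<alpha> x
      by (auto simp: monom_vec_def scalar_prod_def atLeast0LessThan intro!: prod.cong)
    also have "\<dots> = monomial_sum L' d x"
      by (simp add: L L'_def monomial_sum_def)
    also have "\<dots> = (\<Sum>k<length L'. fst (L' ! k) * (\<Prod>i<d. (x $ i) ^ snd (L' ! k) i))"
      by (simp add: monomial_sum_def sum_list_sum_nth case_prod_beta atLeast0LessThan)
    finally show ?thesis .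
  qed
  then show ?thesis by (intro that[of "length L'"]) (auto simp: L'_def)
qed

section \<open>Triangular affine change of variables\<close>

text \<open>The map from y to A y + m for lower triangular A. Row \<open>i\<close> sees only the
  coordinates up to \<open>i\<close>, and the restriction to \<open>{..<d}\<close> keeps the image
  among the extensional functions.\<close>

definition tri_affine :: "nat \<Rightarrow> (nat \<Rightarrow> nat \<Rightarrow> real) \<Rightarrow> (nat \<Rightarrow> real) \<Rightarrow> (nat \<Rightarrow> real) \<Rightarrow> nat \<Rightarrow> real"
  where "tri_affine d a m y = (\<lambda>i\<in>{..<d}. m i + (\<Sum>j\<le>i. a i j * y j))"

lemma space_lborel_dim: "space (lborel_dim d) = PiE {..<d} (\<lambda>_. UNIV)"
  by (simp add: lborel_dim_def space_PiM)

lemma measurable_lborel_dim_component [measurable]: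
  "i < d \<Longrightarrow> (\<lambda>y. y i) \<in> borel_measurable (lborel_dim d)"
  unfolding lborel_dim_def by measurable

lemma measurable_tri_affine [measurable]:
  "tri_affine d a m \<in> measurable (lborel_dim d) (lborel_dim d)"
proof -
  have "(\<lambda>y. m i + (\<Sum>j\<le>i. a i j * y j)) \<in> borel_measurable (lborel_dim d)" if "i < d" for i
    using that by (intro borel_measurable_add borel_measurable_sum borel_measurable_times) auto
  then show ?thesis
    unfolding tri_affine_def lborel_dim_def[of d]
    by (intro measurable_restrict) auto
qed

text \<open>The first \<open>d\<close> rows ignore coordinate \<open>d\<close>, and for fixed
  \<open>y\<close> the new coordinate is affine in \<open>s\<close> with slope \<open>a d d\<close>.
  This lets an induction on \<open>d\<close> treat one variable at a time.\<close>

lemma tri_affine_Suc: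
  assumes "y \<in> space (lborel_dim d)"
  shows "tri_affine (Suc d) a m (y(d := s)) =
    (tri_affine d a m y)(d := (m d + (\<Sum>j<d. a d j * y j)) + a d d * s)"
proof
  fix i
  have "(\<Sum>j\<le>i. a i j * (if j = d then s else y j)) = (\<Sum>j\<le>i. a i j * y j)" if "i < d"
    using that by (intro sum.cong) auto
  moreover have "(\<Sum>j\<le>d. a d j * (if j = d then s else y j)) = (\<Sum>j<d. a d j * y j) + a d d * s"
    unfolding lessThan_Suc_atMost[symmetric] by (simp add: lessThan_Suc)
  ultimately show "tri_affine (Suc d) a m (y(d := s)) i =
    ((tri_affine d a m y)(d := (m d + (\<Sum>j<d. a d j * y j)) + a d d * s)) i"
    by (auto simp: tri_affine_def restrict_def)
qed

lemma nn_integral_lborel_dim_Suc: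
  assumes "f \<in> borel_measurable (lborel_dim (Suc d))"
  shows "(\<integral>\<^sup>+x. f x \<partial>lborel_dim (Suc d)) = (\<integral>\<^sup>+x. (\<integral>\<^sup>+t. f (x(d := t)) \<partial>lborel) \<partial>lborel_dim d)"
proof -
  interpret product_sigma_finite "\<lambda>_::nat. lborel :: real measure" by standard
  show ?thesis
    using product_nn_integral_insert[of "{..<d}" d f] assms
    by (simp add: lborel_dim_def lessThan_Suc)
qed

lemma measurable_fun_upd_lborel_dim [measurable]:
  "(\<lambda>(x, t). x(d := t)) \<in> measurable (lborel_dim d \<Otimes>\<^sub>M lborel) (lborel_dim (Suc d))"
  unfolding lborel_dim_def lessThan_Suc by (rule measurable_add_dim)

text \<open>Induction on the dimension: split off the last coordinate, transform the first
  \<open>d\<close> by the induction hypothesis, then substitute in the last one. Each substitution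
  contributes one diagonal entry to the Jacobian.\<close>

lemma nn_integral_tri_affine:
  assumes "\<And>i. i < d \<Longrightarrow> a i i \<noteq> 0" "f \<in> borel_measurable (lborel_dim d)"
  shows "(\<integral>\<^sup>+x. f x \<partial>lborel_dim d) =
    ennreal \<bar>\<Prod>i<d. a i i\<bar> * (\<integral>\<^sup>+y. f (tri_affine d a m y) \<partial>lborel_dim d)"
  using assms
proof (induction d arbitrary: f)
  case 0
  \<comment> \<open>In dimension 0 the space is a single point, which the map fixes.\<close>
  have "tri_affine 0 a m y = y" if "y \<in> space (lborel_dim 0)" for y
    using that by (auto simp: tri_affine_def space_lborel_dim)
  then show ?case by (simp cong: nn_integral_cong)
next
  case (Suc d)
  note [measurable] = Suc.prems(2)
  have upd [measurable]: "(\<lambda>t. f (x(d := t))) \<in> borel_measurable borel"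
    if "x \<in> space (lborel_dim d)" for x
  proof -
    have "(\<lambda>t. (x, t)) \<in> measurable lborel (lborel_dim d \<Otimes>\<^sub>M lborel)"
      using that by simp
    from measurable_compose[OF measurable_compose[OF this measurable_fun_upd_lborel_dim] Suc.prems(2)]
    show ?thesis by (simp add: fun_upd_def)
  qed
  have space: "tri_affine d a m y \<in> space (lborel_dim d)" for y
    by (simp add: tri_affine_def space_lborel_dim)
  have "(\<lambda>p. f (case p of (x, t) \<Rightarrow> x(d := t))) \<in> borel_measurable (lborel_dim d \<Otimes>\<^sub>M lborel)"
    by measurable
  then have inner: "(\<lambda>x. \<integral>\<^sup>+t. f (x(d := t)) \<partial>lborel) \<in> borel_measurable (lborel_dim d)"
    by (intro lborel.borel_measurable_nn_integral) (simp add: case_prod_beta)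
  have fT [measurable]: "(\<lambda>y. f (tri_affine (Suc d) a m y)) \<in> borel_measurable (lborel_dim (Suc d))"
    by measurable
  have "(\<lambda>p. f (tri_affine (Suc d) a m (case p of (x, t) \<Rightarrow> x(d := t))))
      \<in> borel_measurable (lborel_dim d \<Otimes>\<^sub>M lborel)"
    by measurable
  then have inner': "(\<lambda>y. \<integral>\<^sup>+s. f (tri_affine (Suc d) a m (y(d := s))) \<partial>lborel)
      \<in> borel_measurable (lborel_dim d)"
    by (intro lborel.borel_measurable_nn_integral) (simp add: case_prod_beta)
  have "(\<integral>\<^sup>+x. f x \<partial>lborel_dim (Suc d)) = (\<integral>\<^sup>+x. (\<integral>\<^sup>+t. f (x(d := t)) \<partial>lborel) \<partial>lborel_dim d)"
    by (rule nn_integral_lborel_dim_Suc) fact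
  \<comment> \<open>The induction hypothesis is applied to \<open>f\<close> already integrated over
    the last coordinate, hence the generalisation over \<open>f\<close> and the measurability fact
    \<open>inner\<close>.\<close>
  also have "\<dots> = ennreal \<bar>\<Prod>i<d. a i i\<bar> *
      (\<integral>\<^sup>+y. (\<integral>\<^sup>+t. f ((tri_affine d a m y)(d := t)) \<partial>lborel) \<partial>lborel_dim d)"
    using Suc.prems(1) by (intro Suc.IH inner) auto
  also have "(\<integral>\<^sup>+y. (\<integral>\<^sup>+t. f ((tri_affine d a m y)(d := t)) \<partial>lborel) \<partial>lborel_dim d) =
      (\<integral>\<^sup>+y. ennreal \<bar>a d d\<bar> * (\<integral>\<^sup>+s. f (tri_affine (Suc d) a m (y(d := s))) \<partial>lborel) \<partial>lborel_dim d)"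
  proof (rule nn_integral_cong)
    fix y assume y: "y \<in> space (lborel_dim d)"
    show "(\<integral>\<^sup>+t. f ((tri_affine d a m y)(d := t)) \<partial>lborel) =
        ennreal \<bar>a d d\<bar> * (\<integral>\<^sup>+s. f (tri_affine (Suc d) a m (y(d := s))) \<partial>lborel)"
      unfolding tri_affine_Suc[OF y]
      using Suc.prems(1)[of d] upd[OF space]
      by (subst nn_integral_real_affine[where c = "a d d" and t = "m d + (\<Sum>j<d. a d j * y j)"]) auto
  qed
  also have "\<dots> = ennreal \<bar>a d d\<bar> *
      (\<integral>\<^sup>+y. (\<integral>\<^sup>+s. f (tri_affine (Suc d) a m (y(d := s))) \<partial>lborel) \<partial>lborel_dim d)"
    by (rule nn_integral_cmult) (rule inner')
  also have "(\<integral>\<^sup>+y. (\<integral>\<^sup>+s. f (tri_affine (Suc d) a m (y(d := s))) \<partial>lborel) \<partial>lborel_dim d) =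
      (\<integral>\<^sup>+y. f (tri_affine (Suc d) a m y) \<partial>lborel_dim (Suc d))"
    by (rule nn_integral_lborel_dim_Suc[symmetric]) (rule fT)
  finally show ?case
    by (simp add: lessThan_Suc abs_mult ennreal_mult mult_ac)
qed

text \<open>The substitution rule, tested on indicators, becomes an identity of measures; the rules
  for \<open>density\<close> and \<open>distr\<close> then carry it over to integrals of signed
  functions.\<close>

lemma lborel_dim_tri_affine:
  assumes "\<And>i. i < d \<Longrightarrow> a i i \<noteq> 0"
  shows "lborel_dim d =
    density (distr (lborel_dim d) (lborel_dim d) (tri_affine d a m)) (\<lambda>_. ennreal \<bar>\<Prod>i<d. a i i\<bar>)"
proof (rule measure_eqI)
  fix X assume X: "X \<in> sets (lborel_dim d)"
  let ?D = "distr (lborel_dim d) (lborel_dim d) (tri_affine d a m)"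
  have "emeasure ?D X = (\<integral>\<^sup>+x. indicator X x \<partial>?D)"
    using X by simp
  also have "\<dots> = (\<integral>\<^sup>+y. indicator X (tri_affine d a m y) \<partial>lborel_dim d)"
    using X by (intro nn_integral_distr) auto
  finally have D: "emeasure ?D X = (\<integral>\<^sup>+y. indicator X (tri_affine d a m y) \<partial>lborel_dim d)" .
  have "emeasure (lborel_dim d) X = (\<integral>\<^sup>+x. indicator X x \<partial>lborel_dim d)"
    using X by simp
  also have "\<dots> = ennreal \<bar>\<Prod>i<d. a i i\<bar> * emeasure ?D X"
    unfolding D using X by (intro nn_integral_tri_affine assms) auto
  finally show "emeasure (lborel_dim d) X =
      emeasure (density ?D (\<lambda>_. ennreal \<bar>\<Prod>i<d. a i i\<bar>)) X"
    using X by (simp add: emeasure_density_const)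
qed simp

lemma
  fixes f :: "(nat \<Rightarrow> real) \<Rightarrow> real"
  assumes nz: "\<And>i. i < d \<Longrightarrow> a i i \<noteq> 0"
    and f [measurable]: "f \<in> borel_measurable (lborel_dim d)"
  shows integrable_tri_affine:
      "integrable (lborel_dim d) f \<longleftrightarrow>
        integrable (lborel_dim d) (\<lambda>y. \<bar>\<Prod>i<d. a i i\<bar> * f (tri_affine d a m y))"
    and integral_tri_affine:
      "integral\<^sup>L (lborel_dim d) f =
        (\<integral>y. \<bar>\<Prod>i<d. a i i\<bar> * f (tri_affine d a m y) \<partial>lborel_dim d)"
proof -
  note eq = lborel_dim_tri_affine[of d a m, OF nz]
  show "integrable (lborel_dim d) f \<longleftrightarrow>
        integrable (lborel_dim d) (\<lambda>y. \<bar>\<Prod>i<d. a i i\<bar> * f (tri_affine d a m y))"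
    by (subst (1) eq, simp, subst integrable_density) (auto simp: integrable_distr_eq)
  show "integral\<^sup>L (lborel_dim d) f =
        (\<integral>y. \<bar>\<Prod>i<d. a i i\<bar> * f (tri_affine d a m y) \<partial>lborel_dim d)"
    by (subst (1) eq, simp, subst integral_density) (auto simp: integral_distr)
qed

section \<open>Gaussian densities\<close>

text \<open>Turns the option returned by \<open>mat_inverse\<close> into a genuine inverse, as
  needed to unfold \<open>gauss_density\<close>.\<close>

lemma mat_inverse_SomeE:
  fixes S :: "real mat"
  assumes S: "S \<in> carrier_mat d d" and "det S \<noteq> 0"
  obtains B where "mat_inverse S = Some B" "S * B = 1\<^sub>m d" "B \<in> carrier_mat d d"
proof (cases "mat_inverse S")
  case None
  then show ?thesis
    using mat_inverse(1)[OF S, where b = "()"] det_non_zero_imp_unit[OF assms, of "()"] by blast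
next
  case (Some B)
  then show ?thesis using mat_inverse(2)[OF S] that by blast
qed

text \<open>Put S = A A^T, z = A y and w = S^(-1) z. Then A (A^T w) = A y, and injectivity of A
  gives A^T w = y. Hence the quadratic form z . w equals (A^T w) . y = y . y, while det S is the
  square of det A.\<close>

lemma gauss_density_affine:
  assumes A: "A \<in> carrier_mat d d" and det: "det A \<noteq> 0" and y: "y \<in> carrier_vec d"
    and \<mu>: "\<mu> \<in> carrier_vec d"
  shows "gauss_density d \<mu> (A * A\<^sup>T) (A *\<^sub>v y + \<mu>) =
    exp (- (y \<bullet> y) / 2) / (sqrt (2 * pi) ^ d * \<bar>det A\<bar>)"
proof -
  have S: "A * A\<^sup>T \<in> carrier_mat d d" using A by simp
  have detS: "det (A * A\<^sup>T) = det A ^ 2"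
    using A by (simp add: det_mult[of _ d] det_transpose power2_eq_square)
  obtain B where B: "mat_inverse (A * A\<^sup>T) = Some B" "A * A\<^sup>T * B = 1\<^sub>m d" "B \<in> carrier_mat d d"
    using mat_inverse_SomeE[OF S] det detS by auto
  define z where "z = A *\<^sub>v y"
  define w where "w = B *\<^sub>v z"
  have z: "z \<in> carrier_vec d" using A y by (simp add: z_def)
  have w: "w \<in> carrier_vec d" using B z by (simp add: w_def)
  have Aw: "A\<^sup>T *\<^sub>v w \<in> carrier_vec d" using A w by simp
  have "A *\<^sub>v (A\<^sup>T *\<^sub>v w) = A * A\<^sup>T *\<^sub>v w"
    using A w by (intro assoc_mult_mat_vec[symmetric]) auto
  also have "\<dots> = A * A\<^sup>T * B *\<^sub>v z"
    unfolding w_def using S B(3) z by (intro assoc_mult_mat_vec[symmetric])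
  also have "\<dots> = A *\<^sub>v y" using z by (simp add: B z_def)
  finally have "A *\<^sub>v (A\<^sup>T *\<^sub>v w - y) = 0\<^sub>v d"
    using A Aw y by (simp add: mult_minus_distrib_mat_vec[OF A])
  moreover have "A\<^sup>T *\<^sub>v w - y \<in> carrier_vec d" using Aw y by simp
  ultimately have "A\<^sup>T *\<^sub>v w - y = 0\<^sub>v d"
    using det det_0_iff_vec_prod_zero_field[OF A] by blast
  then have wy: "A\<^sup>T *\<^sub>v w = y"
    using Aw y by (metis minus_add_minus_vec minus_cancel_vec minus_zero_vec eq_vecI 
        carrier_vecD index_minus_vec(1) index_zero_vec(1) right_minus_eq)
  have "z \<bullet> w = w \<bullet> (A *\<^sub>v y)" using z w by (simp add: z_def comm_scalar_prod)
  also have "\<dots> = (A\<^sup>T *\<^sub>v w) \<bullet> y" using transpose_vec_mult_scalar[OF A y w] by simp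
  finally have "z \<bullet> w = y \<bullet> y" by (simp add: wy)
  moreover have "A *\<^sub>v y + \<mu> - \<mu> = z"
    by (intro eq_vecI) (use A \<mu> in \<open>auto simp: z_def\<close>)
  moreover have "sqrt ((2 * pi) ^ d * (det A)\<^sup>2) = sqrt (2 * pi) ^ d * \<bar>det A\<bar>"
    by (simp only: real_sqrt_mult real_sqrt_power[of "2 * pi"] real_sqrt_abs)
  ultimately show ?thesis
    by (simp add: gauss_density_def B detS w_def)
qed

text \<open>The affine formula with the identity matrix and mean 0; the exponential of the sum of
  squares then splits over the coordinates.\<close>

lemma gauss_density_std:
  "gauss_density d (0\<^sub>v d) (1\<^sub>m d) (vec d x) = (\<Prod>i<d. std_normal_density (x i))"
proof -
  have "gauss_density d (0\<^sub>v d) (1\<^sub>m d) (vec d x) =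
      exp (- (vec d x \<bullet> vec d x) / 2) / sqrt (2 * pi) ^ d"
    using gauss_density_affine[of "1\<^sub>m d" d "vec d x" "0\<^sub>v d"] by simp
  also have "vec d x \<bullet> vec d x = (\<Sum>i<d. (x i)\<^sup>2)"
    by (simp add: scalar_prod_def power2_eq_square atLeast0LessThan)
  also have "- (\<Sum>i<d. (x i)\<^sup>2) / 2 = (\<Sum>i<d. - (x i)\<^sup>2 / 2)"
    by (simp add: sum_negf sum_divide_distrib)
  also have "exp (\<Sum>i<d. - (x i)\<^sup>2 / 2) / sqrt (2 * pi) ^ d = (\<Prod>i<d. std_normal_density (x i))"
    by (simp add: std_normal_density_def prod_dividef exp_sum)
  finally show ?thesis .
qed

text \<open>The Jacobian cancels the factor \<open>1 / \<bar>det A\<bar>\<close> of the density, and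
  the standard density at \<open>y\<close> remains.\<close>

lemma gauss_density_affine_std:
  assumes "A \<in> carrier_mat d d" "det A \<noteq> 0" "\<mu> \<in> carrier_vec d"
  shows "\<bar>det A\<bar> * gauss_density d \<mu> (A * A\<^sup>T) (A *\<^sub>v vec d y + \<mu>) =
    (\<Prod>i<d. std_normal_density (y i))"
  using gauss_density_affine[OF assms(1,2) _ assms(3), of "vec d y"]
    gauss_density_affine[of "1\<^sub>m d" d "vec d y" "0\<^sub>v d"] assms(2)
  by (simp flip: gauss_density_std)

lemma measurable_gauss_density [measurable]:
  assumes "\<mu> \<in> carrier_vec d" "B \<in> carrier_mat d d" "mat_inverse S = Some B"
  shows "(\<lambda>x. gauss_density d \<mu> S (vec d x)) \<in> borel_measurable (lborel_dim d)"
proof -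
  \<comment> \<open>Measurability is checked on coordinates, so the quadratic form is first written
    as a double sum in the \<open>x i\<close>.\<close>
  have eq: "(vec d x - \<mu>) \<bullet> (B *\<^sub>v (vec d x - \<mu>)) =
      (\<Sum>i<d. (x i - \<mu> $ i) * (\<Sum>j<d. B $$ (i, j) * (x j - \<mu> $ j)))" for x
    using assms(1,2) by (auto simp: scalar_prod_def atLeast0LessThan intro!: sum.cong)
  show ?thesis
    unfolding gauss_density_def assms(3) option.sel eq by measurable
qed

lemma measurable_monom_vec [measurable]:
  assumes "\<alpha> \<in> carrier_vec d"
  shows "(\<lambda>x. monom_vec (vec d x) \<alpha>) \<in> borel_measurable (lborel_dim d)"
proof -
  have "monom_vec (vec d x) \<alpha> = (\<Prod>i<d. x i ^ (\<alpha> $ i))" for x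
    using assms by (auto simp: monom_vec_def intro!: prod.cong)
  then show ?thesis by simp
qed

section \<open>Moments of the standard Gaussian\<close>

definition std_normal_moment :: "nat \<Rightarrow> real" where
  "std_normal_moment n = (\<integral>t. std_normal_density t * t ^ n \<partial>lborel)"

text \<open>Density and monomial merge into one product of univariate functions, to which Fubini
  applies. This is where the independence of the coordinates enters.\<close>

lemma
  shows integrable_std_gauss_monomial:
      "integrable (lborel_dim d) (\<lambda>y. (\<Prod>i<d. std_normal_density (y i)) * (\<Prod>i<d. y i ^ e i))"
    and integral_std_gauss_monomial:
      "(\<integral>y. (\<Prod>i<d. std_normal_density (y i)) * (\<Prod>i<d. y i ^ e i) \<partial>lborel_dim d) =
        (\<Prod>i<d. std_normal_moment (e i))"
proof -
  interpret product_sigma_finite "\<lambda>_::nat. lborel :: real measure" by standard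
  note int = integrable_std_normal_moment
  show "integrable (lborel_dim d) (\<lambda>y. (\<Prod>i<d. std_normal_density (y i)) * (\<Prod>i<d. y i ^ e i))"
    unfolding prod.distrib[symmetric] lborel_dim_def
    by (rule product_integrable_prod[of "{..<d}" "\<lambda>i t. std_normal_density t * t ^ e i"])
      (auto intro: int)
  show "(\<integral>y. (\<Prod>i<d. std_normal_density (y i)) * (\<Prod>i<d. y i ^ e i) \<partial>lborel_dim d) =
        (\<Prod>i<d. std_normal_moment (e i))"
    unfolding prod.distrib[symmetric] lborel_dim_def std_normal_moment_def
    by (rule product_integral_prod[of "{..<d}" "\<lambda>i t. std_normal_density t * t ^ e i"])
      (auto intro: int)
qed

text \<open>The power of one coordinate is a monomial whose other exponents are 0, so the joint
  moments suffice and no marginal law has to be computed.\<close>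

lemma
  assumes \<eta>: "std_gaussian_vec M d \<eta>" and i: "i < d"
  shows integrable_std_gaussian_vec_power: "integrable M (\<lambda>\<omega>. \<eta> \<omega> i ^ n)"
    and integral_std_gaussian_vec_power: "(\<integral>\<omega>. \<eta> \<omega> i ^ n \<partial>M) = std_normal_moment n"
proof -
  define e where "e = (\<lambda>j. if j = i then n else 0)"
  have D: "distributed M (lborel_dim d) \<eta> (\<lambda>x. ennreal (\<Prod>j<d. std_normal_density (x j)))"
    using \<eta> unfolding std_gaussian_vec_def gauss_density_std .
  have mono: "(\<Prod>j<d. x j ^ e j) = x i ^ n" for x :: "nat \<Rightarrow> real"
    using i by (simp add: e_def if_distrib[of "\<lambda>k. _ ^ k"] prod.delta cong: if_cong)
  \<comment> \<open>The total mass of the normal density: each of the other coordinates contributes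
    a factor 1.\<close>
  have "std_normal_moment 0 = 1" by (simp add: std_normal_moment_def)
  then have mom: "(\<Prod>j<d. std_normal_moment (e j)) = std_normal_moment n"
    using i by (simp add: e_def if_distrib[of std_normal_moment] prod.delta cong: if_cong)
  have g: "(\<lambda>x. x i ^ n) \<in> borel_measurable (lborel_dim d)"
    using i by measurable
  show "integrable M (\<lambda>\<omega>. \<eta> \<omega> i ^ n)"
    using integrable_std_gauss_monomial[of d e] distributed_integrable[OF D g]
    by (simp add: mono prod_nonneg)
  show "(\<integral>\<omega>. \<eta> \<omega> i ^ n \<partial>M) = std_normal_moment n"
    using integral_std_gauss_monomial[of d e] distributed_integral[OF D g]
    by (simp add: mono mom prod_nonneg)
qed

section \<open>Pull-back of the Gaussian moment along the triangular map\<close>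

lemma sym_pos_def_det_factor_nonzero:
  assumes A: "A \<in> carrier_mat d d" and S: "sym_pos_def d (A * A\<^sup>T)"
  shows "det A \<noteq> 0"
proof
  assume "det A = 0"
  then have "det A\<^sup>T = 0" using det_transpose[OF A] by simp
  then obtain v where v: "v \<in> carrier_vec d" "v \<noteq> 0\<^sub>v d" "A\<^sup>T *\<^sub>v v = 0\<^sub>v d"
    using det_0_iff_vec_prod_zero_field[of "A\<^sup>T" d] A by auto
  \<comment> \<open>A nonzero kernel vector of A^T makes the quadratic form of A A^T vanish, against
    positive definiteness.\<close>
  have "A * A\<^sup>T *\<^sub>v v = A *\<^sub>v 0\<^sub>v d"
    using A v by (simp add: assoc_mult_mat_vec[of _ d d _ d])
  also have "\<dots> = 0\<^sub>v d"
    by (intro eq_vecI) (use A in auto)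
  finally have "v \<bullet> (A * A\<^sup>T *\<^sub>v v) = 0" using v by simp
  then show False using S v unfolding sym_pos_def_def by force
qed

text \<open>The substitution x = A y + mu turns the integrand into a finite combination of monomials
  in y times the standard density, so integrability and value both follow term by term.\<close>

lemma
  assumes A: "A \<in> carrier_mat d d" and lower: "lower_triangular A"
    and S: "sym_pos_def d (A * A\<^sup>T)"
    and \<mu>: "\<mu> \<in> carrier_vec d" and \<alpha>: "\<alpha> \<in> carrier_vec d"
    and poly: "\<forall>x\<in>carrier_vec d.
      monom_vec (A *\<^sub>v x + \<mu>) \<alpha> = (\<Sum>k<N. c k * (\<Prod>i<d. (x $ i) ^ e k i))"
  shows integrable_gauss_moment:
      "integrable (lborel_dim d)
        (\<lambda>x. monom_vec (vec d x) \<alpha> * gauss_density d \<mu> (A * A\<^sup>T) (vec d x))"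
    and gauss_moment_eq_sum_std_moments:
      "gauss_moment d \<mu> (A * A\<^sup>T) \<alpha> = (\<Sum>k<N. c k * (\<Prod>i<d. std_normal_moment (e k i)))"
proof -
  let ?f = "\<lambda>x. monom_vec (vec d x) \<alpha> * gauss_density d \<mu> (A * A\<^sup>T) (vec d x)"
  let ?a = "\<lambda>i j. A $$ (i, j)"
  let ?T = "tri_affine d ?a (\<lambda>i. \<mu> $ i)"
  have zero: "A $$ (i, j) = 0" if "i < j" "j < d" for i j
    using lower A that by (auto simp: lower_triangular_def)
  \<comment> \<open>By triangularity the determinant is the Jacobian of \<open>tri_affine\<close>,
    and its being nonzero means that no diagonal entry vanishes.\<close>
  have det: "det A = (\<Prod>i<d. A $$ (i, i))"
    using det_lower_triangular[OF zero A] A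
    by (simp add: prod_list_diag_prod atLeast0LessThan)
  have detA: "det A \<noteq> 0" by (rule sym_pos_def_det_factor_nonzero[OF A S])
  then have nz: "A $$ (i, i) \<noteq> 0" if "i < d" for i
    using that by (auto simp: det)
  have T: "vec d (?T y) = A *\<^sub>v vec d y + \<mu>" for y
  proof (rule eq_vecI)
    fix i assume "i < dim_vec (A *\<^sub>v vec d y + \<mu>)"
    then have i: "i < d" using \<mu> by simp
    \<comment> \<open>Entries to the right of the diagonal vanish, so the truncated row sum of
      \<open>tri_affine\<close> is the full one.\<close>
    have "(\<Sum>j\<le>i. A $$ (i, j) * y j) = (\<Sum>j<d. A $$ (i, j) * y j)"
      using i zero by (intro sum.mono_neutral_left) auto
    then show "vec d (?T y) $ i = (A *\<^sub>v vec d y + \<mu>) $ i"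
      using i A \<mu> by (simp add: tri_affine_def scalar_prod_def atLeast0LessThan)
  qed (use \<mu> in simp)
  have carr: "A * A\<^sup>T \<in> carrier_mat d d" using A by simp
  have "det (A * A\<^sup>T) \<noteq> 0" using A detA by (simp add: det_mult[of _ d] det_transpose)
  then obtain B where "mat_inverse (A * A\<^sup>T) = Some B" "B \<in> carrier_mat d d"
    by (rule mat_inverse_SomeE[OF carr])
  then have f: "?f \<in> borel_measurable (lborel_dim d)"
    using \<mu> \<alpha> by measurable
  have eq: "\<bar>\<Prod>i<d. A $$ (i, i)\<bar> * ?f (?T y) = (\<Sum>k<N. c k *
      ((\<Prod>i<d. std_normal_density (y i)) * (\<Prod>i<d. y i ^ e k i)))" for y
  proof -
    have "\<bar>\<Prod>i<d. A $$ (i, i)\<bar> * ?f (?T y) = monom_vec (A *\<^sub>v vec d y + \<mu>) \<alpha> *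
        (\<bar>det A\<bar> * gauss_density d \<mu> (A * A\<^sup>T) (A *\<^sub>v vec d y + \<mu>))"
      by (simp add: T det)
    also have "\<dots> = (\<Sum>k<N. c k * (\<Prod>i<d. y i ^ e k i)) * (\<Prod>i<d. std_normal_density (y i))"
      by (simp add: gauss_density_affine_std[OF A detA \<mu>] poly)
    also have "\<dots> = (\<Sum>k<N. c k *
        ((\<Prod>i<d. std_normal_density (y i)) * (\<Prod>i<d. y i ^ e k i)))"
      by (subst sum_distrib_right) (intro sum.cong refl, simp only: mult_ac)
    finally show ?thesis .
  qed
  note int = integrable_std_gauss_monomial[of d "e _"]
  show "integrable (lborel_dim d) ?f"
    using integrable_tri_affine[of d ?a ?f "\<lambda>i. \<mu> $ i", OF nz f] int
    by (simp add: eq)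
  show "gauss_moment d \<mu> (A * A\<^sup>T) \<alpha> = (\<Sum>k<N. c k * (\<Prod>i<d. std_normal_moment (e k i)))"
    using integral_tri_affine[of d ?a ?f "\<lambda>i. \<mu> $ i", OF nz f] int
    by (simp add: eq gauss_moment_def integral_std_gauss_monomial)
qed

section \<open>Assembly of the tensor train and of its expectation\<close>

theorem mainTheorem2:
  fixes d p :: nat
    and \<mu> :: "real vec"
    and S A :: "real mat"
    and M :: "'w measure"
    and \<eta> :: "'w \<Rightarrow> nat \<Rightarrow> real"
    and \<alpha> :: "nat vec"
  assumes "d \<ge> 1" and "p \<ge> 1"
    and "\<mu> \<in> carrier_vec d"
    and "sym_pos_def d S"
    and "A \<in> carrier_mat d d" and "lower_triangular A" and "S = A * A\<^sup>T"
    and "prob_space M" and "std_gaussian_vec M d \<eta>"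
    and "\<alpha> \<in> carrier_vec d" and "(\<Sum>i<d. \<alpha> $ i) \<le> 2 * p"
  shows "\<exists>(r :: nat \<Rightarrow> nat) (G0 :: real mat) (G :: nat \<Rightarrow> real \<Rightarrow> real mat).
      (\<forall>i \<le> d. r i \<ge> 1) \<and> r d = 1 \<and>
      G0 \<in> carrier_mat 1 (r 0) \<and>
      (\<forall>i \<in> {1..d}. \<forall>t. G i t \<in> carrier_mat (r (i - 1)) (r i)) \<and>
      (\<forall>i \<in> {1..d}. \<forall>a < r (i - 1). \<forall>b < r i.
         integrable M (\<lambda>\<omega>. G i (\<eta> \<omega> (i - 1)) $$ (a, b))) \<and>
      (\<forall>x \<in> carrier_vec d.
         monom_vec (A *\<^sub>v x + \<mu>) \<alpha> = mat_chain G0 (\<lambda>i. G i (x $ (i - 1))) d $$ (0, 0)) \<and>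
      integrable (lborel_dim d) (\<lambda>x. monom_vec (vec d x) \<alpha> * gauss_density d \<mu> S (vec d x)) \<and>
      gauss_moment d \<mu> S \<alpha> =
        mat_chain G0
          (\<lambda>i. expectation_mat M (r (i - 1)) (r i) (\<lambda>\<omega>. G i (\<eta> \<omega> (i - 1)))) d $$ (0, 0)"
proof -
  note A = assms(5) and \<eta> = assms(9)
  obtain N :: nat and c e where N: "N \<ge> 1" and poly: "\<forall>x\<in>carrier_vec d.
      monom_vec (A *\<^sub>v x + \<mu>) \<alpha> = (\<Sum>k<N. c k * (\<Prod>i<d. (x $ i) ^ e k i))"
    by (rule polynomial_fun_monom_affine[OF A assms(3,10)])
  \<comment> \<open>Every rank is the number of monomials, except the last one.\<close>
  define r where "r = (\<lambda>i. if i < d then N else 1)"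
  define G0 where "G0 = mat 1 N (\<lambda>(_, k). c k)"
  \<comment> \<open>Cores are counted from 1 and coordinates from 0, so core \<open>i\<close>
    carries the variable with index \<open>i - 1\<close>.\<close>
  define G where "G = (\<lambda>i t. cp_core d N i (\<lambda>k. t ^ e k (i - 1)))"
  have G0: "G0 \<in> carrier_mat 1 N" by (simp add: G0_def)
  \<comment> \<open>Kept general in \<open>h\<close>: it evaluates both the chain of powers and the
    chain of their expectations.\<close>
  have chain: "mat_chain G0 (\<lambda>i. cp_core d N i (h i)) d $$ (0, 0) =
      (\<Sum>k<N. c k * (\<Prod>i<d. h (Suc i) k))" for h
    using mat_chain_cp_core[OF G0 assms(1), of h]
    by (simp add: G0_def prod.atLeast1_atMost_eq)
  have r_pred: "r (i - 1) = N" if "i \<in> {1..d}" for i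
    using that by (auto simp: r_def)
  have entry: "G i t $$ (a, b) = (if i < d \<longrightarrow> a = b then t ^ e a (i - 1) else 0)"
    if "a < N" "b < r i" for i t a b
    using that by (auto simp: G_def cp_core_def r_def)
  have pow: "integrable M (\<lambda>\<omega>. \<eta> \<omega> (i - 1) ^ n)"
      "(\<integral>\<omega>. \<eta> \<omega> (i - 1) ^ n \<partial>M) = std_normal_moment n" if "i \<in> {1..d}" for i n
    using that by (auto intro!: integrable_std_gaussian_vec_power[OF \<eta>]
        integral_std_gaussian_vec_power[OF \<eta>])
  \<comment> \<open>Each entry is 0 or a power of one coordinate, so the expectation keeps the shape
    of the core and replaces powers by moments.\<close>
  have exp_G: "expectation_mat M (r (i - 1)) (r i) (\<lambda>\<omega>. G i (\<eta> \<omega> (i - 1))) =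
      cp_core d N i (\<lambda>k. std_normal_moment (e k (i - 1)))" if i: "i \<in> {1..d}" for i
    unfolding expectation_mat_def r_pred[OF i]
    by (rule eq_matI) (auto simp: entry pow[OF i, unfolded One_nat_def] cp_core_def r_def)
  have chain_exp: "mat_chain G0
      (\<lambda>i. expectation_mat M (r (i - 1)) (r i) (\<lambda>\<omega>. G i (\<eta> \<omega> (i - 1)))) d =
      mat_chain G0 (\<lambda>i. cp_core d N i (\<lambda>k. std_normal_moment (e k (i - 1)))) d"
    by (rule mat_chain_cong) (rule exp_G)
  have S: "sym_pos_def d (A * A\<^sup>T)" using assms(4,7) by simp
  show ?thesis
  proof (intro exI[of _ r] exI[of _ G0] exI[of _ G] conjI)
    show "\<forall>i\<le>d. r i \<ge> 1" and "r d = 1" and "G0 \<in> carrier_mat 1 (r 0)"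
      using N G0 assms(1) by (auto simp: r_def)
    show "\<forall>i\<in>{1..d}. \<forall>t. G i t \<in> carrier_mat (r (i - 1)) (r i)"
      using r_pred by (auto simp: G_def cp_core_def r_def)
    show "\<forall>i\<in>{1..d}. \<forall>a<r (i - 1). \<forall>b<r i. integrable M (\<lambda>\<omega>. G i (\<eta> \<omega> (i - 1)) $$ (a, b))"
    proof (intro ballI allI impI)
      fix i a b assume i: "i \<in> {1..d}" and "a < r (i - 1)" and b: "b < r i"
      then have a: "a < N" by (simp only: r_pred)
      show "integrable M (\<lambda>\<omega>. G i (\<eta> \<omega> (i - 1)) $$ (a, b))"
        unfolding entry[OF a b] using pow(1)[OF i] by (cases "i < d \<longrightarrow> a = b") simp_all
    qed
    show "\<forall>x\<in>carrier_vec d.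
        monom_vec (A *\<^sub>v x + \<mu>) \<alpha> = mat_chain G0 (\<lambda>i. G i (x $ (i - 1))) d $$ (0, 0)"
      by (simp add: poly G_def chain)
    show "integrable (lborel_dim d) (\<lambda>x. monom_vec (vec d x) \<alpha> * gauss_density d \<mu> S (vec d x))"
      unfolding assms(7) by (rule integrable_gauss_moment[OF A assms(6) S assms(3,10) poly])
    \<comment> \<open>Both sides reduce to the sum over \<open>k\<close> of \<open>c k\<close> times
      the product of the univariate moments.\<close>
    show "gauss_moment d \<mu> S \<alpha> = mat_chain G0
        (\<lambda>i. expectation_mat M (r (i - 1)) (r i) (\<lambda>\<omega>. G i (\<eta> \<omega> (i - 1)))) d $$ (0, 0)"
      unfolding assms(7) gauss_moment_eq_sum_std_moments[OF A assms(6) S assms(3,10) poly]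
        chain_exp chain
      by simp
  qed
qed

end
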